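(* Suppose the system $x_{t+1}=f(x_t,u_t,w_t)$, $y_t=h(x_t,u_t,w_t)$ admits a quadratically bounded (exponential) $\delta$-IOSS Lyapunov function $W_\delta$ with constants $\eta\in[0,1)$, $P_1,P_2\succ0$, $Q,R\succeq0$ (as defined in the context), and let $\hat x_t$ be the state estimates generated by the MHE scheme described in the context, using these $\eta,P_2,Q,R$ in its cost. Suppose the horizon $M$ is such that $$\rho^M:=4\eta^M\lambda_{\max}(P_2,P_1)<1$$ with $\rho\in[0,1)$. Then, for all $t\in\mathbb{I}_{\ge0}$, the estimation error $\hat e_t=x_t-\hat x_t$ satisfies $$\|\hat e_t\|_{P_1}\le\max\left\{4\sqrt{\rho}^{\,t}\,\|\hat e_0\|_{P_2},\ \max_{j\in\mathbb{I}_{[0,t-1]}}\left\{\frac{4}{1-\sqrt[4]{\rho}}\,\sqrt[4]{\rho}^{\,j}\,\|w_{t-j-1}\|_Q\right\}\right\},$$ i.e., the MHE estimator is robustly globally exponentially stable (RGES).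
   Context: Notation: $\mathbb{I}_{\ge a}$ is the set of integers $\ge a$, $\mathbb{I}_{[a,b]}$ the integers in $[a,b]$. $\|\cdot\|$ is the Euclidean norm and $\|x\|_Q^2=x^\top Qx$ for symmetric positive (semi)definite $Q$. For symmetric positive definite $A,B$, $\lambda_{\max}(A,B)$ is the maximum generalized eigenvalue, i.e. the largest $\lambda$ with $\det(A-\lambda B)=0$. Convention: $0^0=1$; empty sums are $0$ and maxima over empty sets (of nonnegative quantities) are $0$. System: $x_{t+1}=f(x_t,u_t,w_t)$, $y_t=h(x_t,u_t,w_t)$, $t\in\mathbb{I}_{\ge0}$, with $f:\mathbb{R}^n\times\mathbb{R}^m\times\mathbb{R}^q\to\mathbb{R}^n$, $h:\mathbb{R}^n\times\mathbb{R}^m\times\mathbb{R}^q\to\mathbb{R}^p$ continuous. State $x_t$, known input $u_t$, unknown disturbance $w_t$, measured output $y_t$. The true trajectory satisfies $(x_t,u_t,w_t,y_t)\in\mathbb{Z}:=\mathbb{X}\times\mathbb{U}\times\mathbb{W}\times\mathbb{Y}$ for all $t\in\mathbb{I}_{\ge0}$, where $\mathbb{X}\subseteq\mathbb{R}^n$, $\mathbb{U}\subseteq\mathbb{R}^m$, $\mathbb{W}\subseteq\mathbb{R}^q$, $\mathbb{Y}\subseteq\mathbb{R}^p$. An initial guess $\hat x_0\in\mathbb{X}$ of $x_0$ is given. Quadratically bounded (exponential) $\delta$-IOSS Lyapunov function: a function $W_\delta:\mathbb{R}^n\times\mathbb{R}^n\to\mathbb{R}_{\ge0}$ for which there exist $\eta\in[0,1)$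 and symmetric matrices $P_1,P_2\succ0$, $Q,R\succeq0$ such that both (a) $\|x-\tilde x\|_{P_1}^2\le W_\delta(x,\tilde x)\le\|x-\tilde x\|_{P_2}^2$ and (b) $W_\delta(f(x,u,w),f(\tilde x,u,\tilde w))\le\eta W_\delta(x,\tilde x)+\|w-\tilde w\|_Q^2+\|y-\tilde y\|_R^2$ hold for all $(x,u,w,y),(\tilde x,u,\tilde w,\tilde y)\in\mathbb{Z}$, where $y=h(x,u,w)$ and $\tilde y=h(\tilde x,u,\tilde w)$. MHE scheme: fix a horizon $M\in\mathbb{I}_{\ge0}$ and let $M_t=\min\{t,M\}$. At each time $t\in\mathbb{I}_{\ge0}$, given the past estimate $\hat x_{t-M_t}$ and data $u_j,y_j$, $j\in\mathbb{I}_{[t-M_t,t-1]}$, minimize over $\hat x_{t-M_t|t}$ and $\hat w_{\cdot|t}=\{\hat w_{j|t}\}_{j=t-M_t}^{t-1}$ the cost $$V_{\mathrm{MHE}}(\hat x_{t-M_t|t},\hat w_{\cdot|t},\hat y_{\cdot|t},t)=2\eta^{M_t}\|\hat x_{t-M_t|t}-\hat x_{t-M_t}\|_{P_2}^2+\sum_{j=1}^{M_t}\eta^{j-1}\left(2\|\hat w_{t-j|t}\|_Q^2+\|\hat y_{t-j|t}-y_{t-j}\|_R^2\right)$$ subject to $\hat x_{j+1|t}=f(\hat x_{j|t},u_j,\hat w_{j|t})$, $\hat y_{j|t}=h(\hat x_{j|t},u_j,\hat w_{j|t})$, $\hat w_{j|t}\in\mathbb{W}$, $\hat y_{j|t}\in\mathbb{Y}$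 for $j\in\mathbb{I}_{[t-M_t,t-1]}$, and $\hat x_{j|t}\in\mathbb{X}$ for $j\in\mathbb{I}_{[t-M_t,t]}$. A minimizer is assumed to exist at each $t$; it and the corresponding trajectories are denoted by $\hat x^*_{\cdot|t},\hat w^*_{\cdot|t},\hat y^*_{\cdot|t}$. The estimate at time $t$ is $\hat x_t=\hat x^*_{t|t}$ (at $t=0$ this is the initial guess $\hat x_0$). RGES: a state estimator is robustly globally exponentially stable if there exist $\lambda_1,\lambda_2\in[0,1)$ and $C_1,C_2>0$ such that $$\|x_t-\hat x_t\|\le\max\left\{C_1\lambda_1^t\|x_0-\hat x_0\|,\ \max_{j\in\mathbb{I}_{[0,t-1]}}C_2\lambda_2^{t-j-1}\|w_j\|\right\}$$ for all $t\in\mathbb{I}_{\ge0}$, all $x_0,\hat x_0\in\mathbb{X}$, and every trajectory $(x_t,u_t,w_t,y_t)_{t=0}^\infty$ satisfying the system equations and $(x_t,u_t,w_t,y_t)\in\mathbb{Z}$ for all $t$.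
   Formalization: Bound (a) on the δ-IOSS Lyapunov function is required for all x, x̃ in 𝕏 (with 𝕌, 𝕎, 𝕐 nonempty), not only for states whose outputs h lie in 𝕐; otherwise the claim fails, since MHE does not constrain the output at time t. *)

theory Defs
  imports "HOL-Analysis.Analysis"
begin

definition psd_matrix :: "real^'k^'k \<Rightarrow> bool" where
  "psd_matrix A \<longleftrightarrow> transpose A = A \<and> (\<forall>v. 0 \<le> v \<bullet> (A *v v))"

definition pd_matrix :: "real^'k^'k \<Rightarrow> bool" where
  "pd_matrix A \<longleftrightarrow> transpose A = A \<and> (\<forall>v. v \<noteq> 0 \<longrightarrow> 0 < v \<bullet> (A *v v))"

definition wnorm :: "real^'k^'k \<Rightarrow> real^'k \<Rightarrow> real" where
  "wnorm A v = sqrt (v \<bullet> (A *v v))"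

definition gen_eig_max :: "real^'k^'k \<Rightarrow> real^'k^'k \<Rightarrow> real" where
  "gen_eig_max A B = (GREATEST l. det (A - l *\<^sub>R B) = 0)"

text \<open>The maximum of \<open>a 0, \<dots>, a (t - 1)\<close>, with the maximum over the empty set being \<open>0\<close>.\<close>

definition max_below :: "nat \<Rightarrow> (nat \<Rightarrow> real) \<Rightarrow> real" where
  "max_below t a = (if t = 0 then 0 else Max (a ` {..<t}))"

definition system_trajectory ::
  "(real^'n \<Rightarrow> real^'m \<Rightarrow> real^'q \<Rightarrow> real^'n) \<Rightarrow> (real^'n \<Rightarrow> real^'m \<Rightarrow> real^'q \<Rightarrow> real^'p) \<Rightarrow>
   (real^'n) set \<Rightarrow> (real^'m) set \<Rightarrow> (real^'q) set \<Rightarrow> (real^'p) set \<Rightarrow>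
   (nat \<Rightarrow> real^'n) \<Rightarrow> (nat \<Rightarrow> real^'m) \<Rightarrow> (nat \<Rightarrow> real^'q) \<Rightarrow> (nat \<Rightarrow> real^'p) \<Rightarrow> bool" where
  "system_trajectory f h X U W Y x u w y \<longleftrightarrow>
     (\<forall>t. x (Suc t) = f (x t) (u t) (w t) \<and> y t = h (x t) (u t) (w t) \<and>
          (x t, u t, w t, y t) \<in> X \<times> U \<times> W \<times> Y)"

text \<open>The bounds on \<open>V\<close> do not involve the outputs and are imposed for all pairs of points of
  \<open>X \<times> U \<times> W \<times> Y\<close> with a common input; the equations \<open>y = h x u w\<close> and \<open>y' = h x' u w'\<close> only
  restrict the dissipation inequality.\<close>

definition delta_IOSS_lyapunov ::
  "(real^'n \<Rightarrow> real^'m \<Rightarrow> real^'q \<Rightarrow> real^'n) \<Rightarrow> (real^'n \<Rightarrow> real^'m \<Rightarrow> real^'q \<Rightarrow> real^'p) \<Rightarrow>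
   (real^'n) set \<Rightarrow> (real^'m) set \<Rightarrow> (real^'q) set \<Rightarrow> (real^'p) set \<Rightarrow>
   (real^'n \<Rightarrow> real^'n \<Rightarrow> real) \<Rightarrow>
   real \<Rightarrow> real^'n^'n \<Rightarrow> real^'n^'n \<Rightarrow> real^'q^'q \<Rightarrow> real^'p^'p \<Rightarrow> bool" where
  "delta_IOSS_lyapunov f h X U W Y V \<eta> P1 P2 Q R \<longleftrightarrow>
     0 \<le> \<eta> \<and> \<eta> < 1 \<and> pd_matrix P1 \<and> pd_matrix P2 \<and> psd_matrix Q \<and> psd_matrix R \<and>
     (\<forall>x x'. 0 \<le> V x x') \<and>
     (\<forall>x u w y x' w' y'.
        (x, u, w, y) \<in> X \<times> U \<times> W \<times> Y \<and> (x', u, w', y') \<in> X \<times> U \<times> W \<times> Y \<longrightarrow>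
        (wnorm P1 (x - x'))\<^sup>2 \<le> V x x' \<and> V x x' \<le> (wnorm P2 (x - x'))\<^sup>2) \<and>
     (\<forall>x u w y x' w' y'.
        (x, u, w, y) \<in> X \<times> U \<times> W \<times> Y \<and> (x', u, w', y') \<in> X \<times> U \<times> W \<times> Y \<and>
        y = h x u w \<and> y' = h x' u w' \<longrightarrow>
        V (f x u w) (f x' u w') \<le> \<eta> * V x x' + (wnorm Q (w - w'))\<^sup>2 + (wnorm R (y - y'))\<^sup>2)"

text \<open>In the optimization problem at time \<open>t\<close> the decision variables and the trajectories they
  induce are sequences \<open>xs\<close>, \<open>ws\<close>, \<open>ys\<close> indexed by absolute time; only the values at times in
  \<open>[t - min t M, t]\<close> (respectively \<open>[t - min t M, t - 1]\<close>) matter.\<close>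

definition mhe_feasible ::
  "(real^'n \<Rightarrow> real^'m \<Rightarrow> real^'q \<Rightarrow> real^'n) \<Rightarrow> (real^'n \<Rightarrow> real^'m \<Rightarrow> real^'q \<Rightarrow> real^'p) \<Rightarrow>
   (real^'n) set \<Rightarrow> (real^'q) set \<Rightarrow> (real^'p) set \<Rightarrow> nat \<Rightarrow> (nat \<Rightarrow> real^'m) \<Rightarrow> nat \<Rightarrow>
   (nat \<Rightarrow> real^'n) \<Rightarrow> (nat \<Rightarrow> real^'q) \<Rightarrow> (nat \<Rightarrow> real^'p) \<Rightarrow> bool" where
  "mhe_feasible f h X W Y M u t xs ws ys \<longleftrightarrow>
     (\<forall>j\<in>{t - min t M..<t}. xs (Suc j) = f (xs j) (u j) (ws j) \<and> ys j = h (xs j) (u j) (ws j) \<and>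
                             ws j \<in> W \<and> ys j \<in> Y) \<and>
     (\<forall>j\<in>{t - min t M..t}. xs j \<in> X)"

definition mhe_cost ::
  "real \<Rightarrow> real^'n^'n \<Rightarrow> real^'q^'q \<Rightarrow> real^'p^'p \<Rightarrow> nat \<Rightarrow> real^'n \<Rightarrow> (nat \<Rightarrow> real^'p) \<Rightarrow> nat \<Rightarrow>
   real^'n \<Rightarrow> (nat \<Rightarrow> real^'q) \<Rightarrow> (nat \<Rightarrow> real^'p) \<Rightarrow> real" where
  "mhe_cost \<eta> P2 Q R M prior y t xi ws ys =
     2 * \<eta> ^ min t M * (wnorm P2 (xi - prior))\<^sup>2 +
     (\<Sum>j=1..min t M. \<eta> ^ (j - 1) *
        (2 * (wnorm Q (ws (t - j)))\<^sup>2 + (wnorm R (ys (t - j) - y (t - j)))\<^sup>2))"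

definition mhe_minimizer ::
  "(real^'n \<Rightarrow> real^'m \<Rightarrow> real^'q \<Rightarrow> real^'n) \<Rightarrow> (real^'n \<Rightarrow> real^'m \<Rightarrow> real^'q \<Rightarrow> real^'p) \<Rightarrow>
   (real^'n) set \<Rightarrow> (real^'q) set \<Rightarrow> (real^'p) set \<Rightarrow>
   real \<Rightarrow> real^'n^'n \<Rightarrow> real^'q^'q \<Rightarrow> real^'p^'p \<Rightarrow> nat \<Rightarrow>
   real^'n \<Rightarrow> (nat \<Rightarrow> real^'m) \<Rightarrow> (nat \<Rightarrow> real^'p) \<Rightarrow> nat \<Rightarrow>
   (nat \<Rightarrow> real^'n) \<Rightarrow> (nat \<Rightarrow> real^'q) \<Rightarrow> (nat \<Rightarrow> real^'p) \<Rightarrow> bool" where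
  "mhe_minimizer f h X W Y \<eta> P2 Q R M prior u y t xs ws ys \<longleftrightarrow>
     mhe_feasible f h X W Y M u t xs ws ys \<and>
     (\<forall>xs' ws' ys'. mhe_feasible f h X W Y M u t xs' ws' ys' \<longrightarrow>
        mhe_cost \<eta> P2 Q R M prior y t (xs (t - min t M)) ws ys
          \<le> mhe_cost \<eta> P2 Q R M prior y t (xs' (t - min t M)) ws' ys')"

text \<open>\<open>xhat\<close> is a sequence of estimates generated by the scheme from the data \<open>u\<close>, \<open>y\<close> and the
  initial guess \<open>xhat 0\<close>, for some choice of minimizers. At \<open>t = 0\<close> the condition says no more
  than \<open>xhat 0 \<in> X\<close>.\<close>

definition mhe_estimates ::
  "(real^'n \<Rightarrow> real^'m \<Rightarrow> real^'q \<Rightarrow> real^'n) \<Rightarrow> (real^'n \<Rightarrow> real^'m \<Rightarrow> real^'q \<Rightarrow> real^'p) \<Rightarrow>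
   (real^'n) set \<Rightarrow> (real^'q) set \<Rightarrow> (real^'p) set \<Rightarrow>
   real \<Rightarrow> real^'n^'n \<Rightarrow> real^'q^'q \<Rightarrow> real^'p^'p \<Rightarrow> nat \<Rightarrow>
   (nat \<Rightarrow> real^'m) \<Rightarrow> (nat \<Rightarrow> real^'p) \<Rightarrow> (nat \<Rightarrow> real^'n) \<Rightarrow> bool" where
  "mhe_estimates f h X W Y \<eta> P2 Q R M u y xhat \<longleftrightarrow>
     (\<forall>t. \<exists>xs ws ys. mhe_minimizer f h X W Y \<eta> P2 Q R M (xhat (t - min t M)) u y t xs ws ys \<and>
                     xhat t = xs t)"

text \<open>A state estimator maps an initial guess and the input and output sequences to a sequence of
  estimates. Since minimizers need not be unique, there may be many estimators realizing the
  scheme; being one of them includes the existence of minimizers at all times.\<close>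

type_synonym ('n, 'm, 'p) estimator =
  "real^'n \<Rightarrow> (nat \<Rightarrow> real^'m) \<Rightarrow> (nat \<Rightarrow> real^'p) \<Rightarrow> nat \<Rightarrow> real^'n"

definition mhe_estimator ::
  "(real^'n \<Rightarrow> real^'m \<Rightarrow> real^'q \<Rightarrow> real^'n) \<Rightarrow> (real^'n \<Rightarrow> real^'m \<Rightarrow> real^'q \<Rightarrow> real^'p) \<Rightarrow>
   (real^'n) set \<Rightarrow> (real^'m) set \<Rightarrow> (real^'q) set \<Rightarrow> (real^'p) set \<Rightarrow>
   real \<Rightarrow> real^'n^'n \<Rightarrow> real^'q^'q \<Rightarrow> real^'p^'p \<Rightarrow> nat \<Rightarrow> ('n, 'm, 'p) estimator \<Rightarrow> bool" where
  "mhe_estimator f h X U W Y \<eta> P2 Q R M est \<longleftrightarrow>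
     (\<forall>xhat0\<in>X. \<forall>x u w y. system_trajectory f h X U W Y x u w y \<longrightarrow>
        est xhat0 u y 0 = xhat0 \<and>
        mhe_estimates f h X W Y \<eta> P2 Q R M u y (est xhat0 u y))"

definition RGES ::
  "(real^'n \<Rightarrow> real^'m \<Rightarrow> real^'q \<Rightarrow> real^'n) \<Rightarrow> (real^'n \<Rightarrow> real^'m \<Rightarrow> real^'q \<Rightarrow> real^'p) \<Rightarrow>
   (real^'n) set \<Rightarrow> (real^'m) set \<Rightarrow> (real^'q) set \<Rightarrow> (real^'p) set \<Rightarrow>
   ('n, 'm, 'p) estimator \<Rightarrow> bool" where
  "RGES f h X U W Y est \<longleftrightarrow>
     (\<exists>l1 l2 C1 C2. 0 \<le> l1 \<and> l1 < 1 \<and> 0 \<le> l2 \<and> l2 < 1 \<and> 0 < C1 \<and> 0 < C2 \<and>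
        (\<forall>xhat0\<in>X. \<forall>x u w y. system_trajectory f h X U W Y x u w y \<longrightarrow>
           (\<forall>t. norm (x t - est xhat0 u y t)
                  \<le> max (C1 * l1 ^ t * norm (x 0 - xhat0))
                        (max_below t (\<lambda>j. C2 * l2 ^ (t - j - 1) * norm (w j))))))"

end

theory Submission
  imports Defs
begin

text \<open>
  Iterating the dissipation inequality along one estimation window and comparing the optimal cost
  with the cost of the true trajectory, which is feasible, gives
  \<open>V (x t) (xhat t) \<le> 4 \<eta>^N |e (t - N)|^2 + 4 (\<Sum>i<N. \<eta>^i |w (t - i - 1)|^2)\<close> with \<open>N = min t M\<close>, the
  norms being weighted by \<open>P2\<close> and \<open>Q\<close>. The Rayleigh quotient bounds \<open>|e|^2\<close> in the \<open>P2\<close>-norm by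
  \<open>gen_eig_max P2 P1 * V\<close>, so each full window contracts \<open>V\<close> by \<open>\<rho>^M\<close>, and strong induction on \<open>t\<close>
  spans all windows. Taking square roots yields a sum with weights \<open>sqrt \<rho>^i = p^i * p^i\<close>,
  \<open>p = root 4 \<rho>\<close>; one factor \<open>p^i\<close> is summed geometrically, the other stays inside the maximum.
\<close>

section \<open>Quadratic forms\<close>

lemma pd_imp_psd: "pd_matrix A \<Longrightarrow> psd_matrix A"
  unfolding pd_matrix_def psd_matrix_def by (metis inner_zero_left order.refl less_imp_le)

lemma pd_mat_1: "pd_matrix (mat 1)"
  by (simp add: pd_matrix_def)

lemma wnorm_mat_1: "wnorm (mat 1) v = norm v"
  by (simp add: wnorm_def norm_eq_sqrt_inner)

lemma wnorm_power2: "psd_matrix A \<Longrightarrow> (wnorm A v)\<^sup>2 = v \<bullet> (A *v v)"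
  by (simp add: wnorm_def psd_matrix_def)

lemma wnorm_nonneg: "psd_matrix A \<Longrightarrow> 0 \<le> wnorm A v"
  by (simp add: wnorm_def psd_matrix_def)

lemma matrix_vector_mult_minus: "A *v (- v) = - (A *v v)" for A :: "real^'n^'m"
  by (metis matrix_vector_mult_diff_distrib matrix_vector_mult_0_right diff_0)

lemma wnorm_minus_commute: "wnorm A (a - b) = wnorm A (b - a)"
  using matrix_vector_mult_minus[of A "b - a"] by (simp add: wnorm_def inner_diff_left)

lemma wnorm_zero: "wnorm A 0 = 0"
  by (simp add: wnorm_def)

text \<open>Parallelogram law: the two sides differ by the form evaluated at \<open>a + b\<close>,
  which is nonnegative.\<close>

lemma wnorm_diff_power2_le:
  assumes "psd_matrix A"
  shows "(wnorm A (a - b))\<^sup>2 \<le> 2 * (wnorm A a)\<^sup>2 + 2 * (wnorm A b)\<^sup>2"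
proof -
  have "0 \<le> (a + b) \<bullet> (A *v (a + b))"
    using assms by (simp add: psd_matrix_def)
  then show ?thesis
    by (simp add: wnorm_power2[OF assms] matrix_vector_right_distrib matrix_vector_mult_diff_distrib
        inner_add_left inner_add_right inner_diff_left inner_diff_right)
qed

section \<open>Rayleigh quotients and the largest generalized eigenvalue\<close>

lemma quadratic_form_scaleR: "(c *\<^sub>R v) \<bullet> (A *v (c *\<^sub>R v)) = c\<^sup>2 * (v \<bullet> (A *v v))"
  for A :: "real^'n^'n"
  by (simp add: matrix_vector_mult_scaleR power2_eq_square)

text \<open>The quotient is continuous on the compact unit sphere, so it has a maximizer there;
  invariance under scaling extends the bound to every nonzero vector.\<close>

lemma rayleigh_attains_max:
  fixes A B :: "real^'n^'n"
  assumes B: "pd_matrix B"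
  obtains v \<mu> where "v \<noteq> 0" "v \<bullet> (A *v v) = \<mu> * (v \<bullet> (B *v v))"
    "\<And>w. w \<bullet> (A *v w) \<le> \<mu> * (w \<bullet> (B *v w))"
proof -
  let ?q = "\<lambda>w. (w \<bullet> (A *v w)) / (w \<bullet> (B *v w))"
  have pos: "0 < w \<bullet> (B *v w)" if "w \<noteq> 0" for w
    using B that by (simp add: pd_matrix_def)
  have "continuous_on (sphere 0 1) ?q"
    by (intro continuous_intros ballI less_imp_neq[OF pos, symmetric]) auto
  then obtain v where v: "v \<in> sphere 0 1" "\<And>w. w \<in> sphere 0 1 \<Longrightarrow> ?q w \<le> ?q v"
    using continuous_attains_sup[of "sphere (0::real^'n) 1" ?q] by auto
  then have v0: "v \<noteq> 0" by auto
  have "w \<bullet> (A *v w) \<le> ?q v * (w \<bullet> (B *v w))" for w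
  proof (cases "w = 0")
    case False
    have "?q (inverse (norm w) *\<^sub>R w) = ?q w"
      unfolding quadratic_form_scaleR using False by simp
    moreover have "inverse (norm w) *\<^sub>R w \<in> sphere 0 1"
      using False by simp
    ultimately have "?q w \<le> ?q v" using v(2) by metis
    then show ?thesis using pos[OF False] by (simp add: divide_le_eq)
  qed simp
  moreover have "v \<bullet> (A *v v) = ?q v * (v \<bullet> (B *v v))"
    using pos[OF v0] by simp
  ultimately show thesis using v0 that by blast
qed

text \<open>A zero of a nonnegative form is a minimum, so the gradient vanishes. If
  \<open>z = C *v v\<close> were nonzero, a small step from \<open>v\<close> along
  \<open>- z\<close> would make the form negative.\<close>

lemma psd_matrix_kernel:
  assumes C: "psd_matrix C" and v: "v \<bullet> (C *v v) = 0"
  shows "C *v v = 0"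
proof (rule ccontr)
  assume nz: "C *v v \<noteq> 0"
  define z where "z = C *v v"
  define b where "b = z \<bullet> (C *v z)"
  have sym: "v \<bullet> (C *v z) = z \<bullet> z"
    using C by (metis z_def psd_matrix_def dot_lmul_matrix transpose_matrix_vector)
  have q: "0 \<le> 2 * e * (z \<bullet> z) + e\<^sup>2 * b" for e
  proof -
    have "0 \<le> (v + e *\<^sub>R z) \<bullet> (C *v (v + e *\<^sub>R z))"
      using C by (simp add: psd_matrix_def)
    also have "\<dots> = 2 * e * (z \<bullet> z) + e\<^sup>2 * b"
      using v sym by (simp add: matrix_vector_right_distrib matrix_vector_mult_scaleR inner_add_left
          inner_add_right b_def power2_eq_square algebra_simps flip: z_def)
    finally show ?thesis .
  qed
  have a: "0 < z \<bullet> z" using nz by (simp add: z_def)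
  \<comment> \<open>The choice \<open>e = -1\<close> gives
    \<open>b \<ge> 2 * (z \<bullet> z)\<close>, so the parabola in \<open>e\<close> has its minimum
    at \<open>- (z \<bullet> z) / b\<close>, where it is negative.\<close>
  have "b > 0" using q[of "-1"] a unfolding power2_eq_square by linarith
  have "0 \<le> 2 * (- (z \<bullet> z) / b) * (z \<bullet> z) + (- (z \<bullet> z) / b)\<^sup>2 * b" by (rule q)
  also have "\<dots> = - ((z \<bullet> z)\<^sup>2 / b)"
    using \<open>b > 0\<close> by (simp add: field_simps power2_eq_square)
  finally show False using a \<open>b > 0\<close> by (simp add: divide_le_0_iff)
qed

lemma det_eq_0_iff_kernel:
  "det A = 0 \<longleftrightarrow> (\<exists>v. v \<noteq> 0 \<and> A *v v = 0)" for A :: "real^'n^'n"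
  using invertible_det_nz[of A] invertible_left_inverse[of A] matrix_left_invertible_ker[of A] by auto

text \<open>The maximal Rayleigh quotient \<open>\<mu>\<close> is the largest root: the form of
  \<open>\<mu> *\<^sub>R B - A\<close> is nonnegative and vanishes at a maximizer, which is thus a
  kernel vector; conversely, each root is the quotient of its own eigenvector. In particular the
  \<open>GREATEST\<close> in \<open>gen_eig_max\<close> is attained.\<close>

lemma quadratic_form_le_gen_eig_max:
  fixes A B :: "real^'n^'n"
  assumes A: "transpose A = A" and B: "pd_matrix B"
  shows "w \<bullet> (A *v w) \<le> gen_eig_max A B * (w \<bullet> (B *v w))"
proof -
  obtain v \<mu> where v: "v \<noteq> 0" "v \<bullet> (A *v v) = \<mu> * (v \<bullet> (B *v v))"
    and le: "\<And>w. w \<bullet> (A *v w) \<le> \<mu> * (w \<bullet> (B *v w))"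
    using rayleigh_attains_max[OF B] by blast
  define C where "C = \<mu> *\<^sub>R B - A"
  have mult: "C *v w = \<mu> *\<^sub>R (B *v w) - A *v w" for w
    by (simp add: C_def matrix_vector_mult_diff_rdistrib scaleR_matrix_vector_assoc)
  have "transpose C = C"
    using A B by (simp add: C_def pd_matrix_def vec_eq_iff transpose_def)
  then have "psd_matrix C"
    using le by (simp add: psd_matrix_def mult inner_diff_right)
  then have "C *v v = 0"
    by (rule psd_matrix_kernel) (simp add: mult inner_diff_right v)
  then have root: "det (A - \<mu> *\<^sub>R B) = 0"
    unfolding det_eq_0_iff_kernel using v(1)
    by (intro exI[of _ v])
      (simp add: mult matrix_vector_mult_diff_rdistrib flip: scaleR_matrix_vector_assoc)
  have "l \<le> \<mu>" if "det (A - l *\<^sub>R B) = 0" for l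
  proof -
    obtain z where "z \<noteq> 0" "(A - l *\<^sub>R B) *v z = 0"
      using \<open>det (A - l *\<^sub>R B) = 0\<close> unfolding det_eq_0_iff_kernel by blast
    then have z: "z \<noteq> 0" "A *v z = l *\<^sub>R (B *v z)"
      by (simp_all add: matrix_vector_mult_diff_rdistrib scaleR_matrix_vector_assoc)
    then have "l * (z \<bullet> (B *v z)) \<le> \<mu> * (z \<bullet> (B *v z))"
      using le[of z] by simp
    moreover have "0 < z \<bullet> (B *v z)"
      using B z(1) by (simp add: pd_matrix_def)
    ultimately show ?thesis by simp
  qed
  with root have "gen_eig_max A B = \<mu>"
    unfolding gen_eig_max_def by (rule Greatest_equality)
  then show ?thesis using le by simp
qed

lemma wnorm_power2_le_gen_eig_max:
  assumes "pd_matrix A" "pd_matrix B"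
  shows "(wnorm A v)\<^sup>2 \<le> gen_eig_max A B * (wnorm B v)\<^sup>2"
  using quadratic_form_le_gen_eig_max[of A B v] assms
  by (simp add: wnorm_power2 pd_imp_psd) (simp add: pd_matrix_def)

lemma wnorm_le_mult_wnorm:
  fixes A B :: "real^'n^'n"
  assumes B: "pd_matrix B"
  obtains c where "0 < c" "\<And>v. wnorm A v \<le> c * wnorm B v"
proof -
  obtain \<mu> where \<mu>: "\<And>w. w \<bullet> (A *v w) \<le> \<mu> * (w \<bullet> (B *v w))"
    using rayleigh_attains_max[OF B, of A] by blast
  \<comment> \<open>Taking \<open>max \<mu> 1\<close> keeps the constant positive even if
    \<open>\<mu> \<le> 0\<close>, for instance for \<open>A = 0\<close>.\<close>
  have "wnorm A v \<le> sqrt (max \<mu> 1) * wnorm B v" for v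
  proof -
    have "0 \<le> v \<bullet> (B *v v)"
      using pd_imp_psd[OF B] by (simp add: psd_matrix_def)
    then have "v \<bullet> (A *v v) \<le> max \<mu> 1 * (v \<bullet> (B *v v))"
      using \<mu>[of v] by (meson max.cobounded1 mult_right_mono order_trans)
    then show ?thesis
      unfolding wnorm_def by (metis real_sqrt_le_mono real_sqrt_mult)
  qed
  then show thesis using that[of "sqrt (max \<mu> 1)"] by simp
qed

section \<open>Scalar estimates\<close>

lemma max_below_ge: "j < t \<Longrightarrow> a j \<le> max_below t a"
  by (auto simp: max_below_def intro!: Max_ge)

lemma max_below_le:
  assumes "0 \<le> m" "\<And>j. j < t \<Longrightarrow> a j \<le> m"
  shows "max_below t a \<le> m"
  using assms by (auto simp: max_below_def intro!: Max.boundedI)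

lemma max_below_nonneg: "(\<And>j. j < t \<Longrightarrow> 0 \<le> a j) \<Longrightarrow> 0 \<le> max_below t a"
  by (metis max_below_def max_below_ge order_trans order_refl not_gr_zero)

text \<open>Discrete Gronwall inequality. The index \<open>i\<close> counts backwards from the final
  time, like the discounting in the cost.\<close>

lemma iterate_affine_bound:
  fixes a d :: "nat \<Rightarrow> real"
  assumes "\<And>j. j < k \<Longrightarrow> a (Suc j) \<le> \<eta> * a j + d j" "0 \<le> \<eta>"
  shows "a k \<le> \<eta> ^ k * a 0 + (\<Sum>i<k. \<eta> ^ i * d (k - Suc i))"
  using assms(1)
proof (induction k)
  case (Suc k)
  have "a (Suc k) \<le> \<eta> * a k + d k" using Suc.prems by simp
  also have "\<dots> \<le> \<eta> * (\<eta> ^ k * a 0 + (\<Sum>i<k. \<eta> ^ i * d (k - Suc i))) + d k"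
    using Suc assms(2) by (simp add: mult_left_mono)
  also have "\<dots> = \<eta> ^ Suc k * a 0 + (\<Sum>i<Suc k. \<eta> ^ i * d (Suc k - Suc i))"
    by (subst sum.lessThan_Suc_shift) (simp add: sum_distrib_left algebra_simps)
  finally show ?case .
qed simp

lemma sum_lessThan_add:
  "(\<Sum>i<m + n. g i) = (\<Sum>i<m. g i) + (\<Sum>i<n. g (m + i))" for g :: "nat \<Rightarrow> real"
  by (induction n) (simp_all add: add.assoc)

lemma max_bound_of_sum_squares:
  fixes p v E :: real and b :: "nat \<Rightarrow> real"
  assumes p: "0 \<le> p" "p < 1" and E: "0 \<le> E" and b: "\<And>i. i < t \<Longrightarrow> 0 \<le> b i"
    and v: "v\<^sup>2 \<le> 4 * ((p\<^sup>2) ^ t * E)\<^sup>2 + 4 * (\<Sum>i<t. ((p\<^sup>2) ^ i * b i)\<^sup>2)"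
  shows "v \<le> max (4 * (p\<^sup>2) ^ t * E) (max_below t (\<lambda>i. 4 / (1 - p) * p ^ i * b i))"
    (is "_ \<le> max _ ?m")
proof -
  let ?S = "\<Sum>i<t. (p\<^sup>2) ^ i * b i"
  have nn: "0 \<le> ?S" using b by (intro sum_nonneg) simp
  have m: "0 \<le> ?m" using p b by (intro max_below_nonneg) simp
  \<comment> \<open>The l2 norm is at most the l1 norm, so the root of the sum of squares is
    replaced by \<open>?S\<close>.\<close>
  have "L2_set (\<lambda>i. (p\<^sup>2) ^ i * b i) {..<t} \<le> ?S"
    using b by (intro L2_set_le_sum) simp
  then have "(\<Sum>i<t. ((p\<^sup>2) ^ i * b i)\<^sup>2) \<le> ?S\<^sup>2"
    unfolding L2_set_def by (rule sqrt_le_D)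
  with v have "v\<^sup>2 \<le> (2 * ((p\<^sup>2) ^ t * E))\<^sup>2 + (2 * ?S)\<^sup>2"
    by (simp add: power_mult_distrib)
  also have "\<dots> \<le> (2 * ((p\<^sup>2) ^ t * E) + 2 * ?S)\<^sup>2"
    using E nn by (simp add: power2_sum)
  finally have "v\<^sup>2 \<le> (2 * ((p\<^sup>2) ^ t * E) + 2 * ?S)\<^sup>2" .
  then have 1: "v \<le> 2 * ((p\<^sup>2) ^ t * E) + 2 * ?S"
    by (rule power2_le_imp_le) (use E nn in simp)
  \<comment> \<open>One factor \<open>p ^ i\<close> is absorbed into the maximum. The other is
    summed below, where \<open>1 - p\<close> cancels the geometric series up to
    \<open>1 - p ^ t \<le> 1\<close>.\<close>
  have "(p\<^sup>2) ^ i * b i \<le> p ^ i * (?m * (1 - p) / 4)" if "i < t" for i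
  proof -
    have "4 / (1 - p) * p ^ i * b i \<le> ?m"
      using max_below_ge[OF that, of "\<lambda>i. 4 / (1 - p) * p ^ i * b i"] .
    then have "p ^ i * b i \<le> ?m * (1 - p) / 4"
      using p by (simp add: field_simps)
    then have "p ^ i * (p ^ i * b i) \<le> p ^ i * (?m * (1 - p) / 4)"
      by (rule mult_left_mono) (use p in simp)
    then show ?thesis
      by (simp add: power2_eq_square power_mult_distrib mult.assoc)
  qed
  then have "?S \<le> (\<Sum>i<t. p ^ i) * (?m * (1 - p) / 4)"
    unfolding sum_distrib_right by (intro sum_mono) simp
  also have "\<dots> = (1 - p ^ t) * ?m / 4"
    unfolding one_diff_power_eq[of p t] by (simp add: mult_ac)
  also have "\<dots> \<le> ?m / 4"
    using m p by (simp add: algebra_simps)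
  \<comment> \<open>Now \<open>v\<close> is at most half of \<open>4 * (p\<^sup>2) ^ t * E\<close>
    plus half of \<open>?m\<close>, hence at most the larger of the two.\<close>
  finally show ?thesis using 1 by linarith
qed

section \<open>The Lyapunov function along the estimation error\<close>

lemma mhe_cost_eq:
  "mhe_cost \<eta> P2 Q R M prior y t xi ws ys =
     2 * \<eta> ^ min t M * (wnorm P2 (xi - prior))\<^sup>2 +
     (\<Sum>i<min t M. \<eta> ^ i *
        (2 * (wnorm Q (ws (t - Suc i)))\<^sup>2 + (wnorm R (ys (t - Suc i) - y (t - Suc i)))\<^sup>2))"
  by (simp add: mhe_cost_def sum.atLeast1_atMost_eq)

lemma system_trajectoryD:
  assumes "system_trajectory f h X U W Y x u w y"
  shows "x t \<in> X" "u t \<in> U" "w t \<in> W" "y t \<in> Y"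
    "x (Suc t) = f (x t) (u t) (w t)" "y t = h (x t) (u t) (w t)"
  using assms unfolding system_trajectory_def by blast+

lemma trajectory_mhe_feasible:
  assumes "system_trajectory f h X U W Y x u w y"
  shows "mhe_feasible f h X W Y M u t x w y"
  unfolding mhe_feasible_def using system_trajectoryD[OF assms] by blast

text \<open>The weights of the cost fit this estimate: splitting the initial difference at the prior
  and the disturbance difference at zero doubles those terms, while the output residual enters
  undoubled.\<close>

lemma mhe_window_bound:
  assumes L: "delta_IOSS_lyapunov f h X U W Y V \<eta> P1 P2 Q R"
    and traj: "system_trajectory f h X U W Y x u w y"
    and est: "mhe_estimates f h X W Y \<eta> P2 Q R M u y xhat"
  shows "V (x t) (xhat t)
    \<le> 4 * \<eta> ^ min t M * (wnorm P2 (x (t - min t M) - xhat (t - min t M)))\<^sup>2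
      + 4 * (\<Sum>i<min t M. \<eta> ^ i * (wnorm Q (w (t - Suc i)))\<^sup>2)"
proof -
  define N where "N = min t M"
  define s where "s = t - N"
  have sN: "s + N = t" by (simp add: s_def N_def)
  have \<eta>: "0 \<le> \<eta>" and psd: "psd_matrix P2" "psd_matrix Q"
    using L by (auto simp: delta_IOSS_lyapunov_def intro: pd_imp_psd)
  note Z = system_trajectoryD[OF traj]
  obtain xs ws ys where "mhe_minimizer f h X W Y \<eta> P2 Q R M (xhat s) u y t xs ws ys"
    and xt: "xhat t = xs t"
    using est unfolding mhe_estimates_def s_def N_def by blast
  then have feas: "mhe_feasible f h X W Y M u t xs ws ys"
    and opt: "mhe_cost \<eta> P2 Q R M (xhat s) y t (xs s) ws ys
      \<le> mhe_cost \<eta> P2 Q R M (xhat s) y t (x s) w y"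
    using trajectory_mhe_feasible[OF traj] by (auto simp: mhe_minimizer_def s_def N_def)
  let ?A = "(wnorm P2 (x s - xhat s))\<^sup>2" and ?B = "(wnorm P2 (xs s - xhat s))\<^sup>2"
  let ?w = "\<lambda>i. (wnorm Q (w (t - Suc i)))\<^sup>2" and ?ws = "\<lambda>i. (wnorm Q (ws (t - Suc i)))\<^sup>2"
  let ?r = "\<lambda>i. (wnorm R (ys (t - Suc i) - y (t - Suc i)))\<^sup>2"
  define d where "d j = (wnorm Q (w (s + j) - ws (s + j)))\<^sup>2 + (wnorm R (y (s + j) - ys (s + j)))\<^sup>2"
    for j
  have "V (x (s + Suc j)) (xs (s + Suc j)) \<le> \<eta> * V (x (s + j)) (xs (s + j)) + d j" if "j < N" for j
  proof -
    have "s + j \<in> {t - min t M..<t}" using that unfolding s_def N_def by simp linarith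
    with feas have F: "xs (Suc (s + j)) = f (xs (s + j)) (u (s + j)) (ws (s + j))"
      "ys (s + j) = h (xs (s + j)) (u (s + j)) (ws (s + j))" "ws (s + j) \<in> W" "ys (s + j) \<in> Y"
      "xs (s + j) \<in> X"
      unfolding mhe_feasible_def by (blast, blast, blast, blast, auto)
    have "V (f (x (s + j)) (u (s + j)) (w (s + j))) (f (xs (s + j)) (u (s + j)) (ws (s + j)))
      \<le> \<eta> * V (x (s + j)) (xs (s + j)) + (wnorm Q (w (s + j) - ws (s + j)))\<^sup>2
        + (wnorm R (y (s + j) - ys (s + j)))\<^sup>2"
      using L Z[of "s + j"] F(2-) unfolding delta_IOSS_lyapunov_def by blast
    then show ?thesis using F(1) Z(5)[of "s + j"] by (simp add: d_def)
  qed
  then have "V (x t) (xhat t)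
      \<le> \<eta> ^ N * V (x s) (xs s) + (\<Sum>i<N. \<eta> ^ i * d (N - Suc i))"
    using iterate_affine_bound[of N "\<lambda>j. V (x (s + j)) (xs (s + j))" \<eta> d] \<eta> xt sN by simp
  also have "\<dots> \<le> \<eta> ^ N * (2 * ?A + 2 * ?B) + (\<Sum>i<N. \<eta> ^ i * (2 * ?w i + 2 * ?ws i + ?r i))"
  proof (intro add_mono mult_left_mono sum_mono)
    have "xs s \<in> X" using feas sN by (simp add: mhe_feasible_def s_def N_def)
    then have "V (x s) (xs s) \<le> (wnorm P2 (x s - xs s))\<^sup>2"
      using L Z[of s] unfolding delta_IOSS_lyapunov_def by blast
    also have "x s - xs s = (x s - xhat s) - (xs s - xhat s)" by simp
    also have "(wnorm P2 \<dots>)\<^sup>2 \<le> 2 * ?A + 2 * ?B" by (rule wnorm_diff_power2_le[OF psd(1)])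
    finally show "V (x s) (xs s) \<le> 2 * ?A + 2 * ?B" .
  next
    fix i assume "i \<in> {..<N}"
    then have "s + (N - Suc i) = t - Suc i" using sN by simp
    then show "d (N - Suc i) \<le> 2 * ?w i + 2 * ?ws i + ?r i"
      using wnorm_diff_power2_le[OF psd(2), of "w (t - Suc i)" "ws (t - Suc i)"]
      by (simp add: d_def wnorm_minus_commute[of R])
  qed (use \<eta> in auto)
  \<comment> \<open>All terms belonging to the minimizer assemble exactly into the optimal
    cost.\<close>
  also have "\<dots> = 2 * \<eta> ^ N * ?A + 2 * (\<Sum>i<N. \<eta> ^ i * ?w i)
      + mhe_cost \<eta> P2 Q R M (xhat s) y t (xs s) ws ys"
    by (simp add: mhe_cost_eq N_def algebra_simps sum.distrib sum_distrib_left)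
  also have "\<dots> \<le> 2 * \<eta> ^ N * ?A + 2 * (\<Sum>i<N. \<eta> ^ i * ?w i)
      + mhe_cost \<eta> P2 Q R M (xhat s) y t (x s) w y"
    using opt by simp
  \<comment> \<open>The true trajectory has zero output residual, so its cost is a second copy of
    the first two terms and turns each 2 into 4.\<close>
  also have "\<dots> = 4 * \<eta> ^ N * ?A + 4 * (\<Sum>i<N. \<eta> ^ i * ?w i)"
    by (simp add: mhe_cost_eq N_def wnorm_zero algebra_simps sum_distrib_left)
  finally show ?thesis by (simp add: N_def s_def)
qed

text \<open>The factor 4 does not accumulate over windows: together with the eigenvalue it is
  absorbed by \<open>\<rho> ^ M\<close>. Only the oldest window, possibly incomplete, leaves a 4 in
  front of the initial error.\<close>

lemma mhe_lyapunov_bound: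
  assumes L: "delta_IOSS_lyapunov f h X U W Y V \<eta> P1 P2 Q R"
    and \<rho>: "0 \<le> \<rho>" "\<rho> ^ M = 4 * \<eta> ^ M * gen_eig_max P2 P1" and "0 < M" and "\<eta> \<le> \<rho>"
    and traj: "system_trajectory f h X U W Y x u w y"
    and est: "mhe_estimates f h X W Y \<eta> P2 Q R M u y xhat"
    and X: "\<And>t. xhat t \<in> X"
  shows "V (x t) (xhat t)
    \<le> 4 * \<rho> ^ t * (wnorm P2 (x 0 - xhat 0))\<^sup>2
      + 4 * (\<Sum>i<t. \<rho> ^ i * (wnorm Q (w (t - Suc i)))\<^sup>2)"
proof (induction t rule: less_induct)
  case (less t)
  let ?E = "(wnorm P2 (x 0 - xhat 0))\<^sup>2"
  let ?w = "\<lambda>t i. (wnorm Q (w (t - Suc i)))\<^sup>2"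
  have \<eta>: "0 \<le> \<eta>" and pd: "pd_matrix P1" "pd_matrix P2"
    using L by (auto simp: delta_IOSS_lyapunov_def)
  have pow: "\<eta> ^ i \<le> \<rho> ^ i" for i
    using \<eta> \<open>\<eta> \<le> \<rho>\<close> by (simp add: power_mono)
  \<comment> \<open>Only the disturbance weights are relaxed to \<open>\<rho>\<close>; the prior
    term keeps \<open>\<eta>\<close>, since the contraction of a full window needs the exact power
    \<open>\<eta> ^ M\<close>.\<close>
  have win: "V (x t) (xhat t)
    \<le> 4 * \<eta> ^ min t M * (wnorm P2 (x (t - min t M) - xhat (t - min t M)))\<^sup>2
      + 4 * (\<Sum>i<min t M. \<rho> ^ i * ?w t i)"
    using mhe_window_bound[OF L traj est, of t]
      sum_mono[of "{..<min t M}" "\<lambda>i. \<eta> ^ i * ?w t i" "\<lambda>i. \<rho> ^ i * ?w t i"] pow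
    by (simp add: mult_right_mono)
  show ?case
  proof (cases "t < M")
    case True
    have "\<eta> ^ t * ?E \<le> \<rho> ^ t * ?E" by (simp add: pow mult_right_mono)
    then show ?thesis using win True by simp
  next
    case False
    define s where "s = t - M"
    have t: "t = M + s" using False by (simp add: s_def)
    let ?e = "x s - xhat s"
    have V1: "(wnorm P1 ?e)\<^sup>2 \<le> V (x s) (xhat s)"
      using L X[of s] system_trajectoryD(1-4)[OF traj, of s] unfolding delta_IOSS_lyapunov_def by blast
    have "4 * \<eta> ^ M * (wnorm P2 ?e)\<^sup>2 \<le> 4 * \<eta> ^ M * (gen_eig_max P2 P1 * (wnorm P1 ?e)\<^sup>2)"
      using wnorm_power2_le_gen_eig_max[OF pd(2,1)] \<eta> by (intro mult_left_mono) auto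
    also have "\<dots> = \<rho> ^ M * (wnorm P1 ?e)\<^sup>2"
      by (simp add: \<rho>(2))
    also have "\<dots> \<le> \<rho> ^ M * V (x s) (xhat s)"
      using V1 \<rho>(1) by (simp add: mult_left_mono)
    \<comment> \<open>The induction hypothesis applies because \<open>0 < M\<close> makes
      \<open>s < t\<close>.\<close>
    also have "\<dots> \<le> \<rho> ^ M * (4 * \<rho> ^ s * ?E + 4 * (\<Sum>i<s. \<rho> ^ i * ?w s i))"
      using less.IH[of s] t \<open>0 < M\<close> \<rho>(1) by (intro mult_left_mono) auto
    \<comment> \<open>Lag \<open>i\<close> before \<open>s\<close> is lag \<open>M + i\<close>
      before \<open>t\<close>, so these older terms continue the \<open>M\<close> newest ones
      supplied by \<open>win\<close>.\<close>
    also have "\<dots> = 4 * \<rho> ^ t * ?E + 4 * (\<Sum>i<s. \<rho> ^ (M + i) * ?w t (M + i))"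
      by (simp add: t power_add algebra_simps sum_distrib_left)
    finally show ?thesis
      using win sum_lessThan_add[of "\<lambda>i. \<rho> ^ i * ?w t i" M s] by (simp add: t)
  qed
qed

text \<open>The inequalities for \<open>V\<close> hold only at points of \<open>X\<close>, so the
  estimates must be known to lie there.\<close>

lemma mhe_estimates_mem:
  assumes "mhe_estimates f h X W Y \<eta> P2 Q R M u y xhat"
  shows "xhat t \<in> X"
proof -
  obtain xs ws ys where "mhe_feasible f h X W Y M u t xs ws ys" "xhat t = xs t"
    using assms unfolding mhe_estimates_def mhe_minimizer_def by metis
  then show ?thesis by (simp add: mhe_feasible_def)
qed

text \<open>The condition \<open>\<eta> \<le> \<rho>\<close> is derived from a nonzero error at time
  \<open>t\<close>; with zero error the bound is immediate.\<close>

lemma mhe_error_bound: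
  assumes L: "delta_IOSS_lyapunov f h X U W Y V \<eta> P1 P2 Q R"
    and \<rho>: "0 \<le> \<rho>" "\<rho> < 1" "\<rho> ^ M = 4 * \<eta> ^ M * gen_eig_max P2 P1"
    and lt: "4 * \<eta> ^ M * gen_eig_max P2 P1 < 1"
    and traj: "system_trajectory f h X U W Y x u w y"
    and est: "mhe_estimates f h X W Y \<eta> P2 Q R M u y xhat"
  shows "wnorm P1 (x t - xhat t)
    \<le> max (4 * sqrt \<rho> ^ t * wnorm P2 (x 0 - xhat 0))
        (max_below t (\<lambda>j. 4 / (1 - root 4 \<rho>) * root 4 \<rho> ^ j * wnorm Q (w (t - j - 1))))"
proof -
  define p where "p = root 4 \<rho>"
  have p: "0 \<le> p" "p < 1" using \<rho> by (auto simp: p_def)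
  have p4: "p ^ 4 = \<rho>" using \<rho> by (simp add: p_def)
  have p2: "sqrt \<rho> = p\<^sup>2" by (rule real_sqrt_unique) (simp_all flip: p4)
  have \<eta>: "0 \<le> \<eta>" and pd: "pd_matrix P1" "pd_matrix P2" and psd: "psd_matrix Q"
    using L by (auto simp: delta_IOSS_lyapunov_def)
  have psd12: "psd_matrix P1" "psd_matrix P2" using pd pd_imp_psd by auto
  have X: "xhat j \<in> X" for j using mhe_estimates_mem[OF est] .
  note Z = system_trajectoryD[OF traj]
  \<comment> \<open>For \<open>M = 0\<close> the left side of \<open>\<rho>(3)\<close> is 1,
    contradicting \<open>lt\<close>.\<close>
  have "0 < M" using \<rho>(3) lt by (cases M) auto
  have sq: "(wnorm P1 (x t - xhat t))\<^sup>2
    \<le> 4 * ((p\<^sup>2) ^ t * wnorm P2 (x 0 - xhat 0))\<^sup>2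
      + 4 * (\<Sum>i<t. ((p\<^sup>2) ^ i * wnorm Q (w (t - Suc i)))\<^sup>2)"
  proof (cases "x t = xhat t")
    case True
    then show ?thesis by (simp add: wnorm_zero sum_nonneg)
  next
    case False
    let ?e = "x t - xhat t"
    have V12: "(wnorm P1 ?e)\<^sup>2 \<le> V (x t) (xhat t)" "V (x t) (xhat t) \<le> (wnorm P2 ?e)\<^sup>2"
      using L X[of t] Z[of t] unfolding delta_IOSS_lyapunov_def by blast+
    have "0 < (wnorm P1 ?e)\<^sup>2"
      using False pd(1) by (simp add: wnorm_power2[OF psd12(1)] pd_matrix_def)
    \<comment> \<open>The sandwich of \<open>V\<close> between the two norms gives the first
      comparison with the \<open>P2\<close>-norm, the eigenvalue bound the second.\<close>
    moreover have "1 * (wnorm P1 ?e)\<^sup>2 \<le> gen_eig_max P2 P1 * (wnorm P1 ?e)\<^sup>2"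
      using V12 wnorm_power2_le_gen_eig_max[OF pd(2,1), of ?e] by linarith
    ultimately have "1 \<le> gen_eig_max P2 P1"
      using mult_le_cancel_right_pos by blast
    \<comment> \<open>This needs two distinct points in \<open>X\<close>; on a singleton \<open>X\<close>, \<open>\<eta> \<le> \<rho>\<close> can fail.\<close>
    then have "\<eta> ^ M * 1 \<le> \<eta> ^ M * (4 * gen_eig_max P2 P1)"
      using \<eta> by (intro mult_left_mono) auto
    then have "\<eta> ^ M \<le> \<rho> ^ M" using \<rho>(3) by simp
    then have "\<eta> \<le> \<rho>" using \<open>0 < M\<close> \<rho>(1) \<eta> by (simp add: power_mono_iff)
    have sqr: "((p\<^sup>2) ^ i * c)\<^sup>2 = \<rho> ^ i * c\<^sup>2" for i c
      by (simp add: power_mult_distrib mult.commute flip: p4 power_mult)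
    show ?thesis
      using V12(1) mhe_lyapunov_bound[OF L \<rho>(1,3) \<open>0 < M\<close> \<open>\<eta> \<le> \<rho>\<close> traj est X, of t]
      unfolding sqr by simp
  qed
  show ?thesis
    using max_bound_of_sum_squares[OF p wnorm_nonneg[OF psd12(2)] wnorm_nonneg[OF psd] sq]
    unfolding p2 by (simp add: p_def)
qed

section \<open>The explicit bound in weighted norms and RGES in Euclidean norms\<close>

theorem corollary1:
  fixes f :: "real^'n \<Rightarrow> real^'m \<Rightarrow> real^'q \<Rightarrow> real^'n"
    and h :: "real^'n \<Rightarrow> real^'m \<Rightarrow> real^'q \<Rightarrow> real^'p"
    and X :: "(real^'n) set" and U :: "(real^'m) set"
    and W :: "(real^'q) set" and Y :: "(real^'p) set"
    and V :: "real^'n \<Rightarrow> real^'n \<Rightarrow> real"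
    and \<eta> \<rho> :: real
    and P1 P2 :: "real^'n^'n" and Q :: "real^'q^'q" and R :: "real^'p^'p"
    and M :: nat
  assumes "continuous_on UNIV (\<lambda>(x, u, w). f x u w)"
    and "continuous_on UNIV (\<lambda>(x, u, w). h x u w)"
    and "delta_IOSS_lyapunov f h X U W Y V \<eta> P1 P2 Q R"
    and "0 \<le> \<rho>" and "\<rho> < 1"
    and "\<rho> ^ M = 4 * \<eta> ^ M * gen_eig_max P2 P1"
    and "4 * \<eta> ^ M * gen_eig_max P2 P1 < 1"
  shows "(\<forall>x u w y xhat.
            system_trajectory f h X U W Y x u w y \<and>
            mhe_estimates f h X W Y \<eta> P2 Q R M u y xhat \<longrightarrow>
            (\<forall>t. wnorm P1 (x t - xhat t)
                   \<le> max (4 * sqrt \<rho> ^ t * wnorm P2 (x 0 - xhat 0))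
                         (max_below t (\<lambda>j. 4 / (1 - root 4 \<rho>) * root 4 \<rho> ^ j
                                             * wnorm Q (w (t - j - 1)))))) \<and>
         (\<forall>est. mhe_estimator f h X U W Y \<eta> P2 Q R M est \<longrightarrow> RGES f h X U W Y est)"
proof (intro conjI allI impI)
  fix x u w y xhat t
  assume "system_trajectory f h X U W Y x u w y \<and> mhe_estimates f h X W Y \<eta> P2 Q R M u y xhat"
  then show "wnorm P1 (x t - xhat t)
      \<le> max (4 * sqrt \<rho> ^ t * wnorm P2 (x 0 - xhat 0))
          (max_below t (\<lambda>j. 4 / (1 - root 4 \<rho>) * root 4 \<rho> ^ j * wnorm Q (w (t - j - 1))))"
    using mhe_error_bound[OF assms(3-7)] by blast
next
  fix est :: "('n, 'm, 'p) estimator"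
  assume est: "mhe_estimator f h X U W Y \<eta> P2 Q R M est"
  have pd: "pd_matrix P1"
    using assms(3) by (simp add: delta_IOSS_lyapunov_def)
  \<comment> \<open>Norm comparison removes the weights: \<open>c1\<close> converts the error from
    the \<open>P1\<close>-norm, \<open>c2\<close> and \<open>c3\<close> bound the \<open>P2\<close>-
    and \<open>Q\<close>-norms by Euclidean ones.\<close>
  obtain c1 where c1: "0 < c1" "\<And>v. norm v \<le> c1 * wnorm P1 v"
    using wnorm_le_mult_wnorm[OF pd, of "mat 1"] by (auto simp: wnorm_mat_1)
  obtain c2 where c2: "0 < c2" "\<And>v. wnorm P2 v \<le> c2 * norm v"
    using wnorm_le_mult_wnorm[OF pd_mat_1, of P2] by (auto simp: wnorm_mat_1)
  obtain c3 where c3: "0 < c3" "\<And>v. wnorm Q v \<le> c3 * norm v"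
    using wnorm_le_mult_wnorm[OF pd_mat_1, of Q] by (auto simp: wnorm_mat_1)
  define p where "p = root 4 \<rho>"
  have p: "0 \<le> p" "p < 1" using assms(4,5) by (auto simp: p_def)
  define C1 where "C1 = 4 * c1 * c2"
  define C2 where "C2 = 4 / (1 - p) * c1 * c3"
  have C: "0 < C1" "0 < C2" using c1 c2 c3 p by (auto simp: C1_def C2_def)
  have bound: "norm (x t - est xhat0 u y t)
      \<le> max (C1 * sqrt \<rho> ^ t * norm (x 0 - xhat0))
          (max_below t (\<lambda>j. C2 * p ^ (t - j - 1) * norm (w j)))"
    (is "_ \<le> max ?a ?b")
    if "xhat0 \<in> X" and traj: "system_trajectory f h X U W Y x u w y" for xhat0 x u w y t
  proof -
    have e: "est xhat0 u y 0 = xhat0" "mhe_estimates f h X W Y \<eta> P2 Q R M u y (est xhat0 u y)"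
      using est that unfolding mhe_estimator_def by blast+
    let ?m = "max_below t (\<lambda>j. 4 / (1 - p) * p ^ j * wnorm Q (w (t - j - 1)))"
    have "wnorm P1 (x t - est xhat0 u y t)
        \<le> max (4 * sqrt \<rho> ^ t * wnorm P2 (x 0 - xhat0)) ?m"
      using mhe_error_bound[OF assms(3-7) traj e(2), of t] by (simp add: e(1) p_def)
    then have "norm (x t - est xhat0 u y t)
        \<le> c1 * max (4 * sqrt \<rho> ^ t * wnorm P2 (x 0 - xhat0)) ?m"
      using c1 by (meson mult_left_mono less_imp_le order_trans)
    also have "\<dots> = max (c1 * (4 * sqrt \<rho> ^ t * wnorm P2 (x 0 - xhat0))) (c1 * ?m)"
      using c1(1) by (simp add: max_mult_distrib_left)
    also have "\<dots> \<le> max ?a ?b"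
    proof (intro max.mono)
      have "4 * sqrt \<rho> ^ t * c1 * wnorm P2 (x 0 - xhat0)
          \<le> 4 * sqrt \<rho> ^ t * c1 * (c2 * norm (x 0 - xhat0))"
        using c1 c2 assms(4) by (intro mult_left_mono) auto
      then show "c1 * (4 * sqrt \<rho> ^ t * wnorm P2 (x 0 - xhat0)) \<le> ?a"
        by (simp add: C1_def mult_ac)
      have "?m \<le> ?b / c1"
      proof (rule max_below_le)
        \<comment> \<open>This covers \<open>t = 0\<close>, where \<open>?m\<close> takes its
          default value 0.\<close>
        show "0 \<le> ?b / c1"
          using c1 C p by (simp add: max_below_nonneg)
        fix j assume j: "j < t"
        have "4 / (1 - p) * p ^ j * wnorm Q (w (t - j - 1))
            \<le> 4 / (1 - p) * p ^ j * (c3 * norm (w (t - j - 1)))"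
          using c3 p by (intro mult_left_mono) auto
        \<comment> \<open>The explicit bound is indexed by the lag, RGES by the time of the
          disturbance; \<open>t - j - 1\<close> reverses the range and is its own inverse for
          \<open>j < t\<close>.\<close>
        also have "\<dots> = C2 * p ^ (t - (t - j - 1) - 1) * norm (w (t - j - 1)) / c1"
          using c1(1) j by (simp add: C2_def)
        also have "\<dots> \<le> ?b / c1"
          using c1(1) j max_below_ge[of "t - j - 1" t "\<lambda>j. C2 * p ^ (t - j - 1) * norm (w j)"]
          by (intro divide_right_mono) auto
        finally show "4 / (1 - p) * p ^ j * wnorm Q (w (t - j - 1)) \<le> ?b / c1" .
      qed
      then show "c1 * ?m \<le> ?b" using c1(1) by (simp add: field_simps)
    qed
    finally show ?thesis .
  qed
  \<comment> \<open>The decay rates are \<open>sqrt \<rho>\<close> for the initial error and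
    \<open>p\<close> for the disturbances.\<close>
  have "0 \<le> sqrt \<rho>" "sqrt \<rho> < 1"
    using assms(4,5) by simp_all
  with bound C p show "RGES f h X U W Y est"
    unfolding RGES_def by blast
qed

end
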